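(* Let $\mathcal{A}$ be a properly infinite von Neumann algebra acting on a Hilbert space $H$. The set $\widetilde{\mathcal{K}\Phi}_0(\mathcal{A})$ is open in $\mathcal{A}$ (norm topology) and $\widetilde{\mathcal{K}\Phi}_0(\mathcal{A})\subseteq\mathcal{K}\Phi_0(\mathcal{A})$. Moreover, for every $F\in\mathcal{A}$, $$\sigma_{eW}(F)=\bigcap\{\sigma(PF|_{\operatorname{Im}P}) : P\in\mathcal{A}\text{ is a projection such that } I-P \text{ is finite}\},$$ where $PF|_{\operatorname{Im}P}$ is regarded as an operator on $\operatorname{Im}P$.
   Context: Projections are orthogonal projections. A projection of $\mathcal{A}$ is finite if it is not Murray–von Neumann equivalent in $\mathcal{A}$ to any of its proper subprojections. $H=M\tilde\oplus N$ for closed subspaces means $M\cap N=\{0\}$, $M+N=H$. For projections $P,Q\in\mathcal{A}$, $T\in\mathcal{A}$ is invertible up to $(P,Q)$ if there is $B\in\mathcal{A}$ with $B=(I-P)B(I-Q)$, $(I-Q)T(I-P)B=I-Q$ and $B(I-Q)T(I-P)=I-P$. $\mathcal{K}\Phi_0(\mathcal{A})$ is the set of $T\in\mathcal{A}$ for which there are finite projections $P,Q\in\mathcal{A}$ with $P\sim Q$ (Murray–von Neumann equivalence) such that $T$ is invertible up to $(P,Q)$. $\widetilde{\mathcal{K}\Phi}_0(\mathcal{A})$ is the set of $T\in\mathcal{A}$ for which there are finite projections $P,Q\in\mathcal{A}$ such that $T$ maps $(I-P)(H)$ isomorphically onto $(I-Q)(H)$ and $H=(I-Q)(H)\tilde\oplus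 P(H)$. Finally $\sigma_{eW}(F)=\{\lambda\in\mathbb{C}: F-\lambda I\notin\widetilde{\mathcal{K}\Phi}_0(\mathcal{A})\}$. *)

theory Defs
  imports "HOL-Analysis.Analysis"
begin

(* Complex Hilbert spaces (complete, possibly zero). The real inner product, the norm and the
   topology are those induced by the complex inner product, which is linear in its first
   argument. *)
class chilbert_space = real_inner + banach +
  fixes scaleC :: "complex \<Rightarrow> 'a \<Rightarrow> 'a"
    and cinner :: "'a \<Rightarrow> 'a \<Rightarrow> complex"
  assumes scaleC_add_right: "scaleC c (x + y) = scaleC c x + scaleC c y"
    and scaleC_add_left: "scaleC (c + d) x = scaleC c x + scaleC d x"
    and scaleC_scaleC: "scaleC c (scaleC d x) = scaleC (c * d) x"
    and scaleC_of_real: "scaleC (complex_of_real r) x = r *\<^sub>R x"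
    and cinner_commute: "cinner x y = cnj (cinner y x)"
    and cinner_add_left: "cinner (x + y) z = cinner x z + cinner y z"
    and cinner_scaleC_left: "cinner (scaleC c x) y = c * cinner x y"
    and Re_cinner: "Re (cinner x y) = inner x y"

instantiation complex :: chilbert_space
begin

definition scaleC_complex :: "complex \<Rightarrow> complex \<Rightarrow> complex"
  where "scaleC_complex c x = c * x"

definition cinner_complex :: "complex \<Rightarrow> complex \<Rightarrow> complex"
  where "cinner_complex x y = x * cnj y"

instance
  by standard
    (auto simp: scaleC_complex_def cinner_complex_def inner_complex_def algebra_simps
      scaleR_conv_of_real)

end

lemma norm_scaleC: "norm (scaleC c (x :: 'a :: chilbert_space)) = cmod c * norm x"
proof -
  have "cinner (scaleC c x) (scaleC c x) = c * cnj c * cinner x x"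
    by (metis cinner_commute cinner_scaleC_left complex_cnj_mult mult.assoc)
  also have "\<dots> = complex_of_real ((cmod c)\<^sup>2) * cinner x x"
    by (simp add: complex_norm_square del: of_real_power)
  finally have "inner (scaleC c x) (scaleC c x) = (cmod c)\<^sup>2 * inner x x"
    by (metis Re_cinner Re_complex_of_real times_complex.sel(1) Im_complex_of_real
        mult_zero_left diff_zero)
  then show ?thesis
    by (simp add: norm_eq_sqrt_inner real_sqrt_mult)
qed

lemma bounded_linear_scaleC: "bounded_linear (scaleC c :: 'a :: chilbert_space \<Rightarrow> 'a)"
proof (rule bounded_linear_intro[where K = "cmod c"])
  show "scaleC c (x + y) = scaleC c x + scaleC c y" for x y :: 'a
    by (rule scaleC_add_right)
  show "scaleC c (r *\<^sub>R x) = r *\<^sub>R scaleC c x" for r and x :: 'a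
    by (simp add: scaleC_of_real[symmetric] scaleC_scaleC mult.commute)
  show "norm (scaleC c x) \<le> norm x * cmod c" for x :: 'a
    by (simp add: norm_scaleC mult.commute)
qed

lift_definition scalar_op :: "complex \<Rightarrow> 'a \<Rightarrow>\<^sub>L 'a :: chilbert_space" is scaleC
  by (rule bounded_linear_scaleC)

(* B(H): the type of bounded real-linear maps, cut down to the complex-linear ones. Its norm is
   the usual operator norm. *)
definition clinear_ops :: "('a \<Rightarrow>\<^sub>L 'a :: chilbert_space) set"
  where "clinear_ops = {T :: 'a \<Rightarrow>\<^sub>L 'a. \<forall>c x. T (scaleC c x) = scaleC c (T x)}"

definition is_adjoint :: "('a \<Rightarrow>\<^sub>L 'a) \<Rightarrow> ('a \<Rightarrow>\<^sub>L 'a :: chilbert_space) \<Rightarrow> bool"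
  where "is_adjoint S T \<longleftrightarrow> (\<forall>x y. cinner (T x) y = cinner x (S y))"

definition commutant :: "('a \<Rightarrow>\<^sub>L 'a) set \<Rightarrow> ('a \<Rightarrow>\<^sub>L 'a :: chilbert_space) set"
  where "commutant A = {T \<in> clinear_ops. \<forall>S\<in>A. T o\<^sub>L S = S o\<^sub>L T}"

(* Self-adjoint and equal to its bicommutant; hence a unital *-subalgebra of B(H). *)
definition von_neumann_algebra :: "('a \<Rightarrow>\<^sub>L 'a :: chilbert_space) set \<Rightarrow> bool"
  where "von_neumann_algebra A \<longleftrightarrow>
    (\<forall>T\<in>A. \<exists>S\<in>A. is_adjoint S T) \<and> commutant (commutant A) = A"

definition projections :: "('a \<Rightarrow>\<^sub>L 'a) set \<Rightarrow> ('a \<Rightarrow>\<^sub>L 'a :: chilbert_space) set"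
  where "projections A = {P \<in> A. P o\<^sub>L P = P \<and> is_adjoint P P}"

definition mvn_equiv ::
    "('a \<Rightarrow>\<^sub>L 'a) set \<Rightarrow> ('a \<Rightarrow>\<^sub>L 'a) \<Rightarrow> ('a \<Rightarrow>\<^sub>L 'a :: chilbert_space) \<Rightarrow> bool"
  where "mvn_equiv A P Q \<longleftrightarrow>
    (\<exists>V\<in>A. \<exists>W\<in>A. is_adjoint W V \<and> W o\<^sub>L V = P \<and> V o\<^sub>L W = Q)"

definition finite_projection ::
    "('a \<Rightarrow>\<^sub>L 'a) set \<Rightarrow> ('a \<Rightarrow>\<^sub>L 'a :: chilbert_space) \<Rightarrow> bool"
  where "finite_projection A P \<longleftrightarrow> P \<in> projections A \<and>
    \<not> (\<exists>P'\<in>projections A. range (blinfun_apply P') \<subset> range (blinfun_apply P) \<and>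
      mvn_equiv A P P')"

(* No nonzero finite central projection; the algebra on the zero space qualifies vacuously. *)
definition properly_infinite :: "('a \<Rightarrow>\<^sub>L 'a :: chilbert_space) set \<Rightarrow> bool"
  where "properly_infinite A \<longleftrightarrow>
    (\<forall>Z \<in> projections A \<inter> commutant A. finite_projection A Z \<longrightarrow> Z = 0)"

definition direct_sum_decomp :: "'a set \<Rightarrow> 'a :: chilbert_space set \<Rightarrow> bool"
  where "direct_sum_decomp M N \<longleftrightarrow> M \<inter> N = {0} \<and> {x + y |x y. x \<in> M \<and> y \<in> N} = UNIV"

(* Used only for maps that are linear on a closed subspace M; the inverse on N is then
   automatically linear, and its continuity is boundedness. *)
definition isomorphically_onto ::
    "('a \<Rightarrow> 'a) \<Rightarrow> 'a set \<Rightarrow> 'a :: chilbert_space set \<Rightarrow> bool"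
  where "isomorphically_onto f M N \<longleftrightarrow> (\<exists>g. homeomorphism M N f g)"

definition invertible_up_to ::
    "('a \<Rightarrow>\<^sub>L 'a) set \<Rightarrow> ('a \<Rightarrow>\<^sub>L 'a) \<Rightarrow> ('a \<Rightarrow>\<^sub>L 'a) \<Rightarrow> ('a \<Rightarrow>\<^sub>L 'a :: chilbert_space) \<Rightarrow> bool"
  where "invertible_up_to A P Q T \<longleftrightarrow>
    (let P' = id_blinfun - P; Q' = id_blinfun - Q in
      \<exists>B\<in>A. B = P' o\<^sub>L B o\<^sub>L Q' \<and> Q' o\<^sub>L T o\<^sub>L P' o\<^sub>L B = Q' \<and> B o\<^sub>L Q' o\<^sub>L T o\<^sub>L P' = P')"

definition K_Phi0 :: "('a \<Rightarrow>\<^sub>L 'a) set \<Rightarrow> ('a \<Rightarrow>\<^sub>L 'a :: chilbert_space) set"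
  where "K_Phi0 A = {T \<in> A. \<exists>P Q. finite_projection A P \<and> finite_projection A Q \<and>
    mvn_equiv A P Q \<and> invertible_up_to A P Q T}"

definition K_Phi0_tilde :: "('a \<Rightarrow>\<^sub>L 'a) set \<Rightarrow> ('a \<Rightarrow>\<^sub>L 'a :: chilbert_space) set"
  where "K_Phi0_tilde A = {T \<in> A. \<exists>P Q. finite_projection A P \<and> finite_projection A Q \<and>
    isomorphically_onto (blinfun_apply T)
      (range (blinfun_apply (id_blinfun - P))) (range (blinfun_apply (id_blinfun - Q))) \<and>
    direct_sum_decomp (range (blinfun_apply (id_blinfun - Q))) (range (blinfun_apply P))}"

definition sigma_eW :: "('a \<Rightarrow>\<^sub>L 'a) set \<Rightarrow> ('a \<Rightarrow>\<^sub>L 'a :: chilbert_space) \<Rightarrow> complex set"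
  where "sigma_eW A F = {c. F - scalar_op c \<notin> K_Phi0_tilde A}"

(* Spectrum of a bounded complex-linear operator f on the closed subspace M. *)
definition spectrum_on :: "'a :: chilbert_space set \<Rightarrow> ('a \<Rightarrow> 'a) \<Rightarrow> complex set"
  where "spectrum_on M f = {c. \<not> isomorphically_onto (\<lambda>x. f x - scaleC c x) M M}"

end

theory Submission
  imports Defs
begin

text \<open>Everything follows from one characterization (\<open>K_Phi0_tilde_iff_compression\<close>): an operator
\<open>T\<close> of the algebra lies in \<open>K_Phi0_tilde\<close> if and only if some projection \<open>p\<close> with finite
complement makes the compression \<open>p T p\<close> invertible in the corner \<open>p A p\<close>. Applied to
\<open>F - c I\<close>, this is the spectral formula, because \<open>c\<close> avoids the spectrum of \<open>p F\<close> on the range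
of \<open>p\<close> exactly when \<open>p (F - c I) p\<close> is invertible in the corner. It gives openness, because for a
fixed \<open>p\<close> invertibility in a corner survives small perturbations. And it gives the inclusion in
\<open>K_Phi0\<close>, because \<open>T\<close> is then invertible up to \<open>(I - p, I - p)\<close>, a pair of equal and hence
equivalent projections.

To go from finite \<open>P, Q\<close> to a compression, put \<open>p = I - P\<close> and \<open>q = I - Q\<close>. The operator \<open>T\<close> maps
the range of \<open>p\<close> isomorphically onto that of \<open>q\<close>, and since \<open>H\<close> is the direct sum of the range
of \<open>q\<close> and the kernel of \<open>p\<close>, the projection \<open>p\<close> maps the range of \<open>q\<close> bijectively back onto
the range of \<open>p\<close>. The composite of the two maps is \<open>p T p\<close>. The second map has a bounded
inverse by uniform boundedness (\<open>complement_decomp_bounded_below\<close>).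

Conversely, let \<open>p T p\<close> have the inverse \<open>B\<close> in the corner. Then \<open>T p\<close> is bounded below, so its
range is closed and is the range of a projection \<open>q\<close> of the algebra. The operator \<open>T B\<close> is the oblique
projection onto that range along the range of \<open>R = I - p\<close>, whence the direct sum decomposition.
With \<open>Q = I - q\<close> this makes \<open>Q R\<close> an invertible map from the range of \<open>R\<close> onto that of \<open>Q\<close>,
so \<open>Q\<close> is equivalent to the finite projection \<open>R\<close> and is itself finite.

The tool behind both directions is \<open>bounded_below_range_projection\<close>, the polar decomposition of an
operator \<open>X = X P\<close> that is bounded below on the range of \<open>P\<close>: its range projection belongs to the
algebra and is equivalent to \<open>P\<close>, and its inverse belongs to the algebra too. The inverses and the
square roots needed for it come from Banach's fixed point theorem, applied inside the algebra.\<close>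

section \<open>Composition and adjoints\<close>

lemmas comp_bilinear =
  bounded_bilinear.add_left[OF bounded_bilinear_blinfun_compose]
  bounded_bilinear.add_right[OF bounded_bilinear_blinfun_compose]
  bounded_bilinear.diff_left[OF bounded_bilinear_blinfun_compose]
  bounded_bilinear.diff_right[OF bounded_bilinear_blinfun_compose]
  bounded_bilinear.scaleR_left[OF bounded_bilinear_blinfun_compose]
  bounded_bilinear.scaleR_right[OF bounded_bilinear_blinfun_compose]

lemma comp_assoc: "(R o\<^sub>L S) o\<^sub>L T = R o\<^sub>L (S o\<^sub>L T)"
  by (rule blinfun_eqI) simp

lemma comp_id [simp]: "id_blinfun o\<^sub>L T = T" "T o\<^sub>L id_blinfun = T"
  by (rule blinfun_eqI, simp)+

text \<open>The next two facts turn an identity between products into rewrite rules, for operators applied to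
vectors and for longer products bracketed to the right.\<close>
lemma comp_eqD: "R o\<^sub>L S = T \<Longrightarrow> R (S x) = T x"
  by auto

lemma comp_extendD: "R o\<^sub>L S = T \<Longrightarrow> R o\<^sub>L (S o\<^sub>L U) = T o\<^sub>L U"
  by (simp add: comp_assoc[symmetric])

lemma scaleC_minus_right: "scaleC c (x - y) = scaleC c x - scaleC c (y :: 'a :: chilbert_space)"
  by (simp add: bounded_linear_scaleC bounded_linear.linear linear_diff)

lemma scaleC_scaleR: "scaleC c (r *\<^sub>R x) = r *\<^sub>R scaleC c (x :: 'a :: chilbert_space)"
  by (simp add: bounded_linear_scaleC bounded_linear.linear linear_cmul)

text \<open>The imaginary part of the complex inner product is a real inner product after multiplication by
\<open>\<i>\<close>. In this form the adjoint relation is visibly compatible with linear combinations and limits.\<close>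
lemma is_adjoint_iff_inner:
  "is_adjoint S T \<longleftrightarrow> (\<forall>x y. inner (T x) y = inner x (S y) \<and>
    inner (scaleC \<i> (T x)) y = inner (scaleC \<i> x) (S y))"
proof -
  have eq: "cinner x y = Complex (inner x y) (- inner (scaleC \<i> x) y)" for x y :: 'a
    by (rule complex_eqI) (simp_all add: Re_cinner[symmetric] cinner_scaleC_left)
  show ?thesis
    unfolding is_adjoint_def eq by simp
qed

lemma is_adjoint_inner: "is_adjoint S T \<Longrightarrow> inner (T x) y = inner x (S y)"
  by (simp add: is_adjoint_iff_inner)

lemma is_adjoint_sym: "is_adjoint S T \<Longrightarrow> is_adjoint T S"
  unfolding is_adjoint_def by (metis cinner_commute)

lemma is_adjoint_compose:
  "is_adjoint S T \<Longrightarrow> is_adjoint S' T' \<Longrightarrow> is_adjoint (S' o\<^sub>L S) (T o\<^sub>L T')"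
  unfolding is_adjoint_def by simp

lemma is_adjoint_unique:
  assumes "is_adjoint S T" "is_adjoint S' T"
  shows "S = S'"
proof (rule blinfun_eqI)
  fix y
  have "inner x (S y - S' y) = 0" for x
    using is_adjoint_inner[OF assms(1), of x y] is_adjoint_inner[OF assms(2), of x y]
    by (simp add: inner_diff_right)
  from this[of "S y - S' y"] show "S y = S' y"
    by simp
qed

lemma is_adjoint_id: "is_adjoint id_blinfun id_blinfun"
  by (simp add: is_adjoint_def)

lemma is_adjoint_add: "is_adjoint S T \<Longrightarrow> is_adjoint S' T' \<Longrightarrow> is_adjoint (S + S') (T + T')"
  by (simp add: is_adjoint_iff_inner blinfun.bilinear_simps inner_simps scaleC_add_right)

lemma is_adjoint_diff: "is_adjoint S T \<Longrightarrow> is_adjoint S' T' \<Longrightarrow> is_adjoint (S - S') (T - T')"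
  by (simp add: is_adjoint_iff_inner blinfun.bilinear_simps inner_simps scaleC_minus_right)

lemma is_adjoint_scaleR: "is_adjoint S T \<Longrightarrow> is_adjoint (r *\<^sub>R S) (r *\<^sub>R T)"
  by (simp add: is_adjoint_iff_inner blinfun.bilinear_simps inner_simps scaleC_scaleR)

lemma closed_self_adjoint: "closed {T :: 'a :: chilbert_space \<Rightarrow>\<^sub>L 'a. is_adjoint T T}"
proof -
  have "continuous_on UNIV (\<lambda>T :: 'a \<Rightarrow>\<^sub>L 'a. scaleC \<i> (T x))" for x
    by (intro bounded_linear.continuous_on[OF bounded_linear_scaleC] continuous_intros)
  then show ?thesis
    unfolding is_adjoint_iff_inner
    by (intro closed_Collect_all closed_Collect_conj closed_Collect_eq continuous_intros)
qed

lemma closed_corner: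
  fixes P :: "'b :: real_normed_vector \<Rightarrow>\<^sub>L 'b"
  shows "closed {B. P o\<^sub>L B = B}" "closed {B. B o\<^sub>L P = B}"
  by (intro closed_Collect_eq continuous_intros
      bounded_bilinear.continuous_on[OF bounded_bilinear_blinfun_compose])+

section \<open>Projections and partial isometries\<close>

lemma projectionsD:
  assumes "P \<in> projections A"
  shows "P \<in> A" "P o\<^sub>L P = P" "is_adjoint P P" "P (P x) = P x"
proof -
  show "P \<in> A" and P: "P o\<^sub>L P = P" and "is_adjoint P P"
    using assms by (auto simp: projections_def)
  show "P (P x) = P x"
    by (rule comp_eqD[OF P])
qed

lemma range_idempotent_iff:
  assumes "P o\<^sub>L P = P"
  shows "y \<in> range (blinfun_apply P) \<longleftrightarrow> P y = y"
proof
  assume "y \<in> range (blinfun_apply P)"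
  then show "P y = y"
    using comp_eqD[OF assms] by auto
qed (metis rangeI)

text \<open>Taking adjoints in \<open>Q P = P\<close> gives \<open>P Q = P\<close>.\<close>
lemma projection_absorb:
  assumes "is_adjoint P P" "is_adjoint Q Q" "Q o\<^sub>L P = P"
  shows "P o\<^sub>L Q = P"
  using is_adjoint_unique[OF is_adjoint_compose[OF assms(2,1)], of P] assms(1,3) by simp

lemma projection_eqI:
  assumes P: "P \<in> projections A" and Q: "Q \<in> projections A"
    and eq: "range (blinfun_apply P) = range (blinfun_apply Q)"
  shows "P = Q"
proof -
  have "Q o\<^sub>L P = P"
  proof (rule blinfun_eqI)
    show "(Q o\<^sub>L P) x = P x" for x
      using range_idempotent_iff[OF projectionsD(2)[OF Q], of "P x"] eq by auto
  qed
  moreover have "P o\<^sub>L Q = Q"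
  proof (rule blinfun_eqI)
    show "(P o\<^sub>L Q) x = Q x" for x
      using range_idempotent_iff[OF projectionsD(2)[OF P], of "Q x"] eq by auto
  qed
  ultimately show ?thesis
    using projection_absorb[OF projectionsD(3)[OF P] projectionsD(3)[OF Q]] by simp
qed

lemma norm_projection_le:
  assumes "P \<in> projections A"
  shows "norm (P x) \<le> norm x"
proof -
  have "norm (P x) ^ 2 = inner x (P x)"
    using is_adjoint_inner[OF projectionsD(3)[OF assms], of x "P x"] projectionsD(4)[OF assms]
    by (simp add: power2_norm_eq_inner)
  also have "\<dots> \<le> norm x * norm (P x)"
    by (rule norm_cauchy_schwarz)
  finally show ?thesis
    by (cases "P x = 0") (simp_all add: power2_eq_square)
qed

text \<open>Expanding \<open>(V - V P)\<^sup>* (V - V P)\<close> with \<open>V\<^sup>* V = P\<close> gives \<open>P - P - P + P = 0\<close>.\<close>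
lemma partial_isometry_absorb:
  assumes adj: "is_adjoint W V" and P: "W o\<^sub>L V = P" "P o\<^sub>L P = P" "is_adjoint P P"
  shows "V o\<^sub>L P = V" "P o\<^sub>L W = W"
proof -
  have 1: "inner ((V - (V o\<^sub>L P)) x) (V y) = 0" for x y
    using is_adjoint_inner[OF is_adjoint_sym[OF adj], symmetric]
    by (simp add: blinfun.bilinear_simps inner_diff_left
        is_adjoint_inner[OF adj] comp_eqD[OF P(1)] is_adjoint_inner[OF P(3)] comp_eqD[OF P(2)])
  show VP: "V o\<^sub>L P = V"
  proof (rule blinfun_eqI)
    fix x
    have "inner ((V - (V o\<^sub>L P)) x) ((V - (V o\<^sub>L P)) x) = 0"
      using 1[of x x] 1[of x "P x"] by (simp add: blinfun.bilinear_simps inner_diff_right)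
    then show "(V o\<^sub>L P) x = V x"
      by (simp add: blinfun.bilinear_simps)
  qed
  show "P o\<^sub>L W = W"
    by (rule is_adjoint_unique[OF is_adjoint_compose[OF adj P(3), unfolded VP] adj])
qed

section \<open>Operators bounded below\<close>

lemma left_inverse_bounded_below:
  assumes "L o\<^sub>L X = P"
  obtains c where "c > 0" "\<And>x. c * norm (P x) \<le> norm (X x)"
proof (rule that[of "1 / (norm L + 1)"])
  show "1 / (norm L + 1) * norm (P x) \<le> norm (X x)" for x
  proof -
    have "norm (P x) \<le> norm L * norm (X x)"
      using norm_blinfun[of L "X x"] comp_eqD[OF assms, of x] by simp
    also have "\<dots> \<le> (norm L + 1) * norm (X x)"
      by (intro mult_right_mono) auto
    finally show ?thesis
      by (simp add: field_simps add_pos_nonneg)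
  qed
qed (simp add: add_nonneg_pos)

lemma isomorphically_onto_cong:
  assumes "\<And>x. x \<in> M \<Longrightarrow> f x = f' x"
  shows "isomorphically_onto f M N \<longleftrightarrow> isomorphically_onto f' M N"
  unfolding isomorphically_onto_def
  by (intro ex_cong1 iffI; erule homeomorphism_cong; simp add: assms)

text \<open>The inverse is homogeneous, so continuity at \<open>0\<close> already bounds it.\<close>
lemma isomorphically_onto_bounded_below:
  assumes iso: "isomorphically_onto (blinfun_apply T) (range (blinfun_apply P)) N"
  obtains c where "c > 0" "\<And>x. c * norm (P x) \<le> norm (T (P x))"
proof -
  obtain g where g: "homeomorphism (range (blinfun_apply P)) N (blinfun_apply T) g"
    using iso by (auto simp: isomorphically_onto_def)
  have gT: "g (T (P x)) = P x" and TN: "T (P x) \<in> N" for x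
    using g by (auto simp: homeomorphism_def)
  have "g 0 = 0" "0 \<in> N"
    using gT[of 0] TN[of 0] by simp_all
  moreover have "continuous_on N g"
    using g by (simp add: homeomorphism_def)
  ultimately have "\<exists>d>0. \<forall>y\<in>N. dist y 0 < d \<longrightarrow> dist (g y) 0 < 1"
    unfolding continuous_on_iff by (metis zero_less_one)
  then obtain d where d: "d > 0" "\<And>y. y \<in> N \<Longrightarrow> norm y < d \<Longrightarrow> norm (g y) < 1"
    by auto
  show thesis
  proof (rule that[of d])
    show "d * norm (P x) \<le> norm (T (P x))" for x
    proof (cases "P x = 0")
      case False
      have "norm (g (T (P ((1 / norm (P x)) *\<^sub>R x)))) = 1"
        unfolding gT using False by (simp add: blinfun.bilinear_simps)
      then have "d \<le> norm (T (P ((1 / norm (P x)) *\<^sub>R x)))"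
        using d(2)[OF TN] by (metis less_irrefl not_le_imp_less)
      then have "d \<le> norm (T (P x)) / norm (P x)"
        by (simp add: blinfun.bilinear_simps)
      then show ?thesis
        using False by (simp add: field_simps)
    qed simp
  qed (use d in simp)
qed

text \<open>The uniform boundedness principle for functionals given by the inner product. By Baire, one of the
closed sets of vectors on which all the functionals are bounded by \<open>n\<close> contains a ball, and on a
translate of that ball to the origin they are bounded by \<open>2 n\<close>.\<close>
lemma weakly_bounded_imp_bounded:
  fixes S :: "'b :: {real_inner, banach} set"
  assumes "\<And>h. \<exists>M. \<forall>z\<in>S. \<bar>inner z h\<bar> \<le> M"
  obtains C where "C > 0" "\<And>z. z \<in> S \<Longrightarrow> norm z \<le> C"
proof -
  define F where "F n = {h. \<forall>z\<in>S. \<bar>inner z h\<bar> \<le> real n}" for n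
  have closed_F: "closed (F n)" for n
    unfolding F_def Ball_def imp_conv_disj
    by (intro closed_Collect_all closed_Collect_disj closed_Collect_le closed_Collect_const
        continuous_intros)
  have "h \<in> (\<Union>n. F n)" for h
  proof -
    obtain M where "\<forall>z\<in>S. \<bar>inner z h\<bar> \<le> M"
      using assms by blast
    moreover obtain n where "M \<le> real n"
      using real_arch_simple by blast
    ultimately have "h \<in> F n"
      unfolding F_def by fastforce
    then show ?thesis
      by blast
  qed
  then have cover: "(\<Union>n. F n) = UNIV"
    by blast
  have "\<exists>n. interior (F n) \<noteq> {}"
  proof (rule ccontr)
    assume "\<not> (\<exists>n. interior (F n) \<noteq> {})"
    then have "Met_TC.mtopology interior_of \<Union>(range F) = {}"
      using closed_F
      by (intro Met_TC.metric_Baire_category_alt)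
        (auto simp: complete_UNIV)
    then show False
      using cover by simp
  qed
  then obtain n h0 where "h0 \<in> interior (F n)"
    by blast
  then obtain r where r: "r > 0" "cball h0 r \<subseteq> F n"
    using mem_interior_cball by blast
  \<comment> \<open>The summand \<open>1\<close> only serves to make the bound positive.\<close>
  show thesis
  proof (rule that[of "(2 * real n + 1) / r"])
    show "norm z \<le> (2 * real n + 1) / r" if "z \<in> S" for z
    proof (cases "z = 0")
      case False
      define h where "h = (r / norm z) *\<^sub>R z"
      have "h0 \<in> F n" "h0 + h \<in> F n"
        using r by (auto simp: h_def dist_norm)
      then have "\<bar>inner z h0\<bar> \<le> n" "\<bar>inner z h0 + inner z h\<bar> \<le> n"
        using that by (auto simp: F_def inner_add_right)
      moreover have "inner z h = r * norm z"
        using False by (simp add: h_def dot_square_norm power2_eq_square)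
      ultimately have "r * norm z \<le> 2 * real n + 1"
        by linarith
      then show ?thesis
        using r(1) by (simp add: field_simps)
    qed (use r(1) in simp)
  qed (use r(1) in simp)
qed

text \<open>Closed complements meet at a positive angle. Let \<open>y\<close> be in the range of \<open>p\<close> with \<open>q y\<close> in the unit
ball. Any vector \<open>h\<close> splits as \<open>q a + (I - p) b\<close>, and the second summand is orthogonal to \<open>y\<close>, so
\<open>\<langle>y, h\<rangle> = \<langle>q y, a\<rangle>\<close> is bounded by \<open>norm a\<close> uniformly in \<open>y\<close>. Thus these \<open>y\<close> form a weakly
bounded set, which is bounded.\<close>
lemma complement_decomp_bounded_below:
  assumes p: "p \<in> projections A" and q: "q \<in> projections A"
    and decomp: "direct_sum_decomp (range (blinfun_apply q)) (range (blinfun_apply (id_blinfun - p)))"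
  obtains c where "c > 0" "\<And>x. c * norm (p x) \<le> norm (q (p x))"
proof -
  note pr = projectionsD[OF p] and qr = projectionsD[OF q]
  define S where "S = {y. p y = y \<and> norm (q y) \<le> 1}"
  have pair: "inner y h = inner (q y) a"
    if "p y = y" "h = q a + (b - p b)" for y h a b
  proof -
    have "inner y (b - p b) = inner (y - p y) b"
      by (simp add: inner_diff_left inner_diff_right is_adjoint_inner[OF pr(3)])
    moreover have "inner y (q a) = inner (q y) a"
      by (simp add: is_adjoint_inner[OF qr(3)])
    ultimately show ?thesis
      using that by (simp add: inner_add_right)
  qed
  have split: "\<exists>a b. h = q a + (b - p b)" for h
  proof -
    have "h \<in> {x + y |x y. x \<in> range (blinfun_apply q) \<and> y \<in> range (blinfun_apply (id_blinfun - p))}"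
      using decomp by (simp add: direct_sum_decomp_def)
    then show ?thesis
      by (auto simp: blinfun.bilinear_simps)
  qed
  have "\<exists>M. \<forall>y\<in>S. \<bar>inner y h\<bar> \<le> M" for h
  proof -
    obtain a b where ab: "h = q a + (b - p b)"
      using split by blast
    have "\<bar>inner y h\<bar> \<le> norm a" if "y \<in> S" for y
    proof -
      have "\<bar>inner y h\<bar> \<le> norm (q y) * norm a"
        using pair[OF _ ab, of y] that Cauchy_Schwarz_ineq2[of "q y" a] by (simp add: S_def)
      also have "\<dots> \<le> 1 * norm a"
        using that by (intro mult_right_mono) (auto simp: S_def)
      finally show ?thesis
        by simp
    qed
    then show ?thesis
      by blast
  qed
  then obtain C where C: "C > 0" "\<And>y. y \<in> S \<Longrightarrow> norm y \<le> C"
    using weakly_bounded_imp_bounded by metis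
  have "(1 / C) * norm (p x) \<le> norm (q (p x))" for x
  proof (cases "q (p x) = 0")
    case True
    obtain a b where "p x = q a + (b - p b)"
      using split by blast
    from pair[OF _ this, of "p x"] True have "inner (p x) (p x) = 0"
      by (simp add: pr(4))
    then show ?thesis
      by simp
  next
    case False
    define y where "y = (1 / norm (q (p x))) *\<^sub>R p x"
    have "y \<in> S"
      using False by (simp add: S_def y_def blinfun.bilinear_simps pr(4))
    from C(2)[OF this] show ?thesis
      using False C(1) by (simp add: y_def field_simps)
  qed
  then show thesis
    using that[of "1 / C"] C(1) by simp
qed

section \<open>Von Neumann algebras\<close>

lemma commutant_closed: "closed (commutant A)"
proof -
  have 1: "closed (clinear_ops :: ('a \<Rightarrow>\<^sub>L 'a) set)"
    unfolding clinear_ops_def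
    by (intro closed_Collect_all closed_Collect_eq continuous_intros
        bounded_linear.continuous_on[OF bounded_linear_scaleC])
  have "commutant A = clinear_ops \<inter> (\<Inter>S\<in>A. {T. T o\<^sub>L S = S o\<^sub>L T})"
    by (auto simp: commutant_def)
  also have "closed \<dots>"
    by (intro closed_Int 1 closed_INT ballI closed_Collect_eq continuous_intros
        bounded_bilinear.continuous_on[OF bounded_bilinear_blinfun_compose])
  finally show ?thesis .
qed

lemma commutant_compose:
  assumes S: "S \<in> commutant A" and T: "T \<in> commutant A"
  shows "S o\<^sub>L T \<in> commutant A"
proof -
  have "(S o\<^sub>L T) o\<^sub>L U = U o\<^sub>L (S o\<^sub>L T)" if "U \<in> A" for U
  proof -
    have "T o\<^sub>L U = U o\<^sub>L T" "S o\<^sub>L U = U o\<^sub>L S"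
      using S T that by (auto simp: commutant_def)
    then show ?thesis
      by (simp add: comp_assoc comp_extendD[of S U "U o\<^sub>L S"])
  qed
  then show ?thesis
    using S T by (auto simp: commutant_def clinear_ops_def)
qed

lemma commutant_add: "S \<in> commutant A \<Longrightarrow> T \<in> commutant A \<Longrightarrow> S + T \<in> commutant A"
  by (auto simp: commutant_def clinear_ops_def comp_bilinear blinfun.bilinear_simps scaleC_add_right)

lemma commutant_diff: "S \<in> commutant A \<Longrightarrow> T \<in> commutant A \<Longrightarrow> S - T \<in> commutant A"
  by (auto simp: commutant_def clinear_ops_def comp_bilinear blinfun.bilinear_simps scaleC_minus_right)

lemma commutant_scaleR: "T \<in> commutant A \<Longrightarrow> r *\<^sub>R T \<in> commutant A"
  by (auto simp: commutant_def clinear_ops_def comp_bilinear blinfun.bilinear_simps scaleC_scaleR)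

lemma commutant_id: "id_blinfun \<in> commutant A"
  by (simp add: commutant_def clinear_ops_def)

lemma scalar_op_commutant: "A \<subseteq> clinear_ops \<Longrightarrow> scalar_op c \<in> commutant A"
  unfolding commutant_def clinear_ops_def
  by (auto simp: scalar_op.rep_eq scaleC_scaleC mult.commute intro!: blinfun_eqI)

locale vn_algebra =
  fixes A :: "('a :: chilbert_space \<Rightarrow>\<^sub>L 'a) set"
  assumes vna: "von_neumann_algebra A"
begin

lemma bicommutant: "commutant (commutant A) = A"
  using vna by (simp add: von_neumann_algebra_def)

lemma adjoint_ex:
  assumes "T \<in> A" obtains S where "S \<in> A" "is_adjoint S T"
  using assms vna by (auto simp: von_neumann_algebra_def)

lemma closed: "closed A"
  and compose: "S \<in> A \<Longrightarrow> T \<in> A \<Longrightarrow> S o\<^sub>L T \<in> A"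
  and add: "S \<in> A \<Longrightarrow> T \<in> A \<Longrightarrow> S + T \<in> A"
  and diff: "S \<in> A \<Longrightarrow> T \<in> A \<Longrightarrow> S - T \<in> A"
  and scaleR: "T \<in> A \<Longrightarrow> r *\<^sub>R T \<in> A"
  and one: "id_blinfun \<in> A"
  using commutant_closed[of "commutant A"] commutant_compose[of _ "commutant A"]
    commutant_add[of _ "commutant A"] commutant_diff[of _ "commutant A"]
    commutant_scaleR[of _ "commutant A"] commutant_id[of "commutant A"]
  by (simp_all add: bicommutant)

lemma scalar: "scalar_op c \<in> A"
  using scalar_op_commutant[of "commutant A" c] bicommutant by (auto simp: commutant_def)

lemma complement: "P \<in> projections A \<Longrightarrow> id_blinfun - P \<in> projections A"
  by (auto simp: projections_def comp_bilinear intro: diff one is_adjoint_diff is_adjoint_id)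

section \<open>Inverses and square roots in a corner\<close>

text \<open>A right and a left inverse of \<open>Z\<close> in the corner are the fixed points of the contractions
\<open>B \<mapsto> P + (P - Z) B\<close> and \<open>B \<mapsto> P + B (P - Z)\<close>, whose iterates are the partial sums of the
Neumann series. Working with fixed points inside the closed set \<open>A\<close> shows at once that the inverse
belongs to the algebra.\<close>
lemma corner_neumann:
  assumes P: "P \<in> projections A" and Z: "Z \<in> A" "P o\<^sub>L Z = Z" "Z o\<^sub>L P = Z"
    and small: "norm (P - Z) < 1"
  obtains B where "B \<in> A" "P o\<^sub>L B = B" "B o\<^sub>L P = B" "Z o\<^sub>L B = P" "B o\<^sub>L Z = P"
proof -
  note Pr = projectionsD[OF P]
  have contraction: "dist (P + ((P - Z) o\<^sub>L B)) (P + ((P - Z) o\<^sub>L B')) \<le> norm (P - Z) * dist B B'"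
    "dist (P + (B o\<^sub>L (P - Z))) (P + (B' o\<^sub>L (P - Z))) \<le> norm (P - Z) * dist B B'" for B B'
    using norm_blinfun_compose[of "P - Z" "B - B'"] norm_blinfun_compose[of "B - B'" "P - Z"]
    by (simp_all add: dist_norm comp_bilinear algebra_simps)
  have "\<exists>!B. B \<in> A \<inter> {B. P o\<^sub>L B = B} \<and> P + ((P - Z) o\<^sub>L B) = B"
  proof (rule Banach_fix)
    show "complete (A \<inter> {B. P o\<^sub>L B = B})"
      unfolding complete_eq_closed by (intro closed_Int closed closed_corner)
    show "A \<inter> {B. P o\<^sub>L B = B} \<noteq> {}"
      using Pr by auto
    show "(\<lambda>B. P + ((P - Z) o\<^sub>L B)) ` (A \<inter> {B. P o\<^sub>L B = B}) \<subseteq> A \<inter> {B. P o\<^sub>L B = B}"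
      using Pr Z by (auto intro!: add compose diff simp: comp_bilinear comp_extendD)
  qed (use small contraction in auto)
  then obtain B where B: "B \<in> A" "P o\<^sub>L B = B" "P + ((P - Z) o\<^sub>L B) = B"
    by auto
  have "\<exists>!B. B \<in> A \<inter> {B. B o\<^sub>L P = B} \<and> P + (B o\<^sub>L (P - Z)) = B"
  proof (rule Banach_fix)
    show "complete (A \<inter> {B. B o\<^sub>L P = B})"
      unfolding complete_eq_closed by (intro closed_Int closed closed_corner)
    show "A \<inter> {B. B o\<^sub>L P = B} \<noteq> {}"
      using Pr by auto
    show "(\<lambda>B. P + (B o\<^sub>L (P - Z))) ` (A \<inter> {B. B o\<^sub>L P = B}) \<subseteq> A \<inter> {B. B o\<^sub>L P = B}"
      using Pr Z by (auto intro!: add compose diff simp: comp_bilinear comp_assoc)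
  qed (use small contraction in auto)
  then obtain B' where B': "B' \<in> A" "B' o\<^sub>L P = B'" "P + (B' o\<^sub>L (P - Z)) = B'"
    by auto
  have ZB: "Z o\<^sub>L B = P" and BZ: "B' o\<^sub>L Z = P"
    using B B' by (simp_all add: comp_bilinear)
  have "B' = B' o\<^sub>L (Z o\<^sub>L B)"
    using ZB B'(2) by simp
  also have "\<dots> = B"
    using BZ B(2) by (simp add: comp_assoc[symmetric])
  finally have "B' = B" .
  with that B B' ZB BZ show thesis
    by blast
qed

text \<open>Write \<open>S = P - D\<close> and look for the root in the form \<open>P - Y\<close>. The equation \<open>(P - Y)\<^sup>2 = P - D\<close>
says \<open>Y = (D + Y\<^sup>2) / 2\<close>, a fixed point problem that preserves the self-adjoint elements of the
corner. The last conclusion makes the root itself invertible in the corner.\<close>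
lemma corner_sqrt:
  assumes P: "P \<in> projections A"
    and S: "S \<in> A" "P o\<^sub>L S = S" "S o\<^sub>L P = S" "is_adjoint S S"
    and small: "norm (P - S) < 1"
  obtains C where "C \<in> A" "P o\<^sub>L C = C" "C o\<^sub>L P = C" "is_adjoint C C" "C o\<^sub>L C = S"
    "norm (P - C) < 1"
proof -
  note Pr = projectionsD[OF P]
  define D where "D = P - S"
  \<comment> \<open>The smaller root of \<open>r\<^sup>2 - 2 r + norm D = 0\<close>: the map \<open>Y \<mapsto> (D + Y\<^sup>2) / 2\<close> sends the ball
    of radius \<open>r\<close> to itself and contracts it by the factor \<open>r\<close>.\<close>
  define r where "r = 1 - sqrt (1 - norm D)"
  have "sqrt (1 - norm D) * sqrt (1 - norm D) = 1 - norm D"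
    using small by (simp add: D_def)
  then have r: "0 \<le> r" "r < 1" "(norm D + r * r) / 2 = r"
    using small by (auto simp: r_def D_def field_simps)
  define M where "M = A \<inter> {Y. P o\<^sub>L Y = Y} \<inter> {Y. Y o\<^sub>L P = Y} \<inter> {Y. is_adjoint Y Y} \<inter> cball 0 r"
  have D: "D \<in> A" "P o\<^sub>L D = D" "D o\<^sub>L P = D" "is_adjoint D D"
    unfolding D_def using Pr S by (auto intro: diff is_adjoint_diff simp: comp_bilinear)
  have "\<exists>!Y. Y \<in> M \<and> (1/2) *\<^sub>R (D + (Y o\<^sub>L Y)) = Y"
  proof (rule Banach_fix)
    show "complete M"
      unfolding M_def complete_eq_closed
      by (intro closed_Int closed closed_corner closed_self_adjoint closed_cball)
    have "0 \<in> M"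
      using r diff[OF Pr(1) Pr(1)] is_adjoint_diff[OF Pr(3) Pr(3)] by (simp add: M_def)
    then show "M \<noteq> {}"
      by auto
    have "norm ((1/2) *\<^sub>R (D + (Y o\<^sub>L Y))) \<le> r" if "norm Y \<le> r" for Y
    proof -
      have "norm (D + (Y o\<^sub>L Y)) \<le> norm D + norm Y * norm Y"
        by (rule order_trans[OF norm_triangle_ineq add_left_mono[OF norm_blinfun_compose]])
      also have "\<dots> \<le> norm D + r * r"
        using that by (intro add_left_mono mult_mono) (use r in auto)
      finally show ?thesis
        using r(3) by simp
    qed
    then show "(\<lambda>Y. (1/2) *\<^sub>R (D + (Y o\<^sub>L Y))) ` M \<subseteq> M"
      using D unfolding M_def
      by (auto intro!: scaleR add compose is_adjoint_scaleR is_adjoint_add is_adjoint_compose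
          simp: comp_bilinear comp_extendD comp_assoc simp del: norm_scaleR)
    show "dist ((1/2) *\<^sub>R (D + (Y o\<^sub>L Y))) ((1/2) *\<^sub>R (D + (Y' o\<^sub>L Y'))) \<le> r * dist Y Y'"
      if "Y \<in> M" "Y' \<in> M" for Y Y'
    proof -
      have "(1/2) *\<^sub>R (D + (Y o\<^sub>L Y)) - (1/2) *\<^sub>R (D + (Y' o\<^sub>L Y'))
          = (1/2) *\<^sub>R ((Y o\<^sub>L (Y - Y')) + ((Y - Y') o\<^sub>L Y'))"
        by (simp add: comp_bilinear scaleR_diff_right scaleR_add_right)
      moreover have "norm ((Y o\<^sub>L (Y - Y')) + ((Y - Y') o\<^sub>L Y'))
          \<le> norm Y * norm (Y - Y') + norm (Y - Y') * norm Y'"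
        by (intro order_trans[OF norm_triangle_ineq] add_mono norm_blinfun_compose)
      moreover have "\<dots> \<le> r * norm (Y - Y') + norm (Y - Y') * r"
        using that by (intro add_mono mult_left_mono mult_right_mono) (auto simp: M_def)
      ultimately show ?thesis
        by (simp add: dist_norm)
    qed
  qed (use r in auto)
  then obtain Y where Y: "Y \<in> M" "(1/2) *\<^sub>R (D + (Y o\<^sub>L Y)) = Y"
    by auto
  have "D + (Y o\<^sub>L Y) = 2 *\<^sub>R ((1/2) *\<^sub>R (D + (Y o\<^sub>L Y)))"
    by simp
  then have YY: "D + (Y o\<^sub>L Y) = Y + Y"
    unfolding Y(2) by (simp add: scaleR_2)
  show thesis
  proof (rule that[of "P - Y"])
    show "P - Y \<in> A" "P o\<^sub>L (P - Y) = P - Y" "(P - Y) o\<^sub>L P = P - Y" "is_adjoint (P - Y) (P - Y)"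
      using Pr Y(1) by (auto simp: M_def comp_bilinear intro: diff is_adjoint_diff)
    have "(P - Y) o\<^sub>L (P - Y) = P - (Y + Y) + (Y o\<^sub>L Y)"
      using Pr Y(1) by (simp add: M_def comp_bilinear)
    then show "(P - Y) o\<^sub>L (P - Y) = S"
      unfolding YY[symmetric] by (simp add: D_def)
    show "norm (P - (P - Y)) < 1"
      using Y(1) r by (simp add: M_def)
  qed
qed

section \<open>Range projections\<close>

text \<open>With \<open>S = X\<^sup>* X\<close>, expanding the square of \<open>norm (P x - t S x)\<close> gives a term linear in \<open>t\<close> that
lowers it by at least \<open>2 t c\<^sup>2 (norm (P x))\<^sup>2\<close>, against a quadratic error. A small \<open>t\<close> therefore
brings \<open>t S\<close> within distance less than \<open>1\<close> of \<open>P\<close>.\<close>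
lemma bounded_below_rescaled_modulus:
  assumes P: "P \<in> projections A" and XP: "X o\<^sub>L P = X"
    and c: "c > 0" "\<And>x. c * norm (P x) \<le> norm (X x)" and adj: "is_adjoint Y X"
  obtains t where "t > 0" "norm (P - t *\<^sub>R (Y o\<^sub>L X)) < 1"
proof -
  note Pr = projectionsD[OF P]
  define S where "S = Y o\<^sub>L X"
  define K where "K = (norm S)\<^sup>2 + c ^ 4 + 1"
  \<comment> \<open>This \<open>t\<close> minimizes \<open>1 - 2 t c\<^sup>2 + t\<^sup>2 K\<close>. The summand \<open>c ^ 4\<close> in \<open>K\<close> keeps the minimum
    \<open>1 - c ^ 4 / K\<close> positive.\<close>
  define t where "t = c\<^sup>2 / K"
  have K: "K > 0" "c ^ 4 < K" "(norm S)\<^sup>2 \<le> K"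
    using c(1) by (auto simp: K_def add_nonneg_pos)
  have "P o\<^sub>L Y = Y"
    using is_adjoint_unique[OF is_adjoint_compose[OF adj Pr(3)], of Y] XP adj by simp
  from comp_eqD[OF this] have PS: "P (Y x) = Y x" for x .
  have SP: "S (P x) = S x" for x
    using comp_eqD[OF XP] by (simp add: S_def)
  have "norm ((P - t *\<^sub>R S) x) \<le> sqrt (1 - c ^ 4 / K) * norm x" for x
  proof -
    have cross: "inner (P x) (S x) = (norm (X x))\<^sup>2"
      using is_adjoint_inner[OF Pr(3), of x "S x"] is_adjoint_inner[OF adj, of x "X x"]
      by (simp add: PS S_def power2_norm_eq_inner)
    have square_of_difference: "(norm (a - t *\<^sub>R b))\<^sup>2
        = (norm a)\<^sup>2 - 2 * t * inner a b + t\<^sup>2 * (norm b)\<^sup>2" for a b :: 'a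
      unfolding power2_norm_eq_inner
      by (simp add: inner_diff_left inner_diff_right inner_commute[of b a] power2_eq_square
          right_diff_distrib)
    have low: "c\<^sup>2 * (norm (P x))\<^sup>2 \<le> (norm (X x))\<^sup>2"
      using power_mono[OF c(2)[of x], of 2] c(1) by (simp add: power_mult_distrib)
    have "norm (S x) \<le> norm S * norm (P x)"
      using norm_blinfun[of S "P x"] by (simp add: SP)
    from power_mono[OF this, of 2]
    have up: "(norm (S x))\<^sup>2 \<le> K * (norm (P x))\<^sup>2"
      using mult_right_mono[OF K(3), of "(norm (P x))\<^sup>2"] by (simp add: power_mult_distrib)
    have "(norm ((P - t *\<^sub>R S) x))\<^sup>2
        = (norm (P x))\<^sup>2 - 2 * t * (norm (X x))\<^sup>2 + t\<^sup>2 * (norm (S x))\<^sup>2"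
      using square_of_difference[of "P x" "S x"] cross by (simp add: blinfun.bilinear_simps)
    also have "\<dots> \<le> (norm (P x))\<^sup>2 - 2 * t * (c\<^sup>2 * (norm (P x))\<^sup>2) + t\<^sup>2 * (K * (norm (P x))\<^sup>2)"
      using low up K(1) c(1)
      by (intro add_mono diff_mono mult_left_mono) (auto simp: t_def)
    also have "\<dots> = (1 - c ^ 4 / K) * (norm (P x))\<^sup>2"
      using K(1) by (simp add: t_def field_simps power2_eq_square power4_eq_xxxx)
    also have "\<dots> \<le> (1 - c ^ 4 / K) * (norm x)\<^sup>2"
      using norm_projection_le[OF P, of x] K by (intro mult_left_mono power_mono) auto
    finally have "(norm ((P - t *\<^sub>R S) x))\<^sup>2 \<le> (sqrt (1 - c ^ 4 / K) * norm x)\<^sup>2"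
      using K by (simp add: power_mult_distrib)
    then show ?thesis
      by (rule power2_le_imp_le) (use K in simp)
  qed
  then have "norm (P - t *\<^sub>R S) \<le> sqrt (1 - c ^ 4 / K)"
    using K by (intro norm_blinfun_bound) auto
  also have "\<dots> < 1"
    using K c(1) by simp
  finally show thesis
    using that[of t] K(1) c(1) by (simp add: S_def t_def)
qed

text \<open>Polar decomposition for an operator bounded below on the range of \<open>P\<close>. If \<open>C\<close> is the square root of
\<open>t X\<^sup>* X\<close> in the corner, with inverse \<open>G\<close>, then \<open>V = sqrt t X G\<close> satisfies \<open>V\<^sup>* V = P\<close>, and
\<open>V V\<^sup>* = X B\<close> with \<open>B = t G\<^sup>2 X\<^sup>*\<close> is the projection onto the range of \<open>X\<close>.\<close>
lemma bounded_below_range_projection: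
  assumes P: "P \<in> projections A" and X: "X \<in> A" "X o\<^sub>L P = X"
    and c: "c > 0" "\<And>x. c * norm (P x) \<le> norm (X x)"
  obtains E B where "E \<in> projections A" "range (blinfun_apply E) = range (blinfun_apply X)"
    "mvn_equiv A P E" "B \<in> A" "P o\<^sub>L B = B" "B o\<^sub>L E = B" "B o\<^sub>L X = P" "X o\<^sub>L B = E"
proof -
  note Pr = projectionsD[OF P]
  obtain Y where Y: "Y \<in> A" "is_adjoint Y X"
    using adjoint_ex[OF X(1)] .
  obtain t where t: "t > 0" "norm (P - t *\<^sub>R (Y o\<^sub>L X)) < 1"
    using bounded_below_rescaled_modulus[OF P X(2) c Y(2)] .
  have PY: "P o\<^sub>L Y = Y"
    using is_adjoint_unique[OF is_adjoint_compose[OF Y(2) Pr(3)], of Y] X(2) Y(2) by simp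
  define S where "S = t *\<^sub>R (Y o\<^sub>L X)"
  have S: "S \<in> A" "P o\<^sub>L S = S" "S o\<^sub>L P = S" "is_adjoint S S" "norm (P - S) < 1"
    unfolding S_def using Y X(2) t(2) is_adjoint_sym[OF Y(2)]
    by (auto intro!: scaleR compose X Y is_adjoint_scaleR is_adjoint_compose
        simp: comp_bilinear comp_assoc comp_extendD[OF PY])
  obtain C where C: "C \<in> A" "P o\<^sub>L C = C" "C o\<^sub>L P = C" "is_adjoint C C" "C o\<^sub>L C = S"
    "norm (P - C) < 1"
    using corner_sqrt[OF P S] .
  obtain G where G: "G \<in> A" "P o\<^sub>L G = G" "G o\<^sub>L P = G" "C o\<^sub>L G = P" "G o\<^sub>L C = P"
    using corner_neumann[OF P C(1-3,6)] .
  obtain G' where G': "is_adjoint G' G"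
    using adjoint_ex[OF G(1)] .
  have "G' = G' o\<^sub>L P"
    by (rule is_adjoint_unique[OF G' is_adjoint_compose[OF Pr(3) G', unfolded G(2)]])
  also have "\<dots> = (G' o\<^sub>L C) o\<^sub>L G"
    by (simp add: comp_assoc G(4))
  also have "G' o\<^sub>L C = P"
    by (rule is_adjoint_unique[OF is_adjoint_compose[OF C(4) G', unfolded G(4)] Pr(3)])
  finally have "G' = G"
    by (simp add: G(2))
  with G' have Gadj: "is_adjoint G G"
    by simp
  have GGS: "G o\<^sub>L (G o\<^sub>L S) = P"
    using G C by (simp add: C(5)[symmetric] comp_extendD[OF G(5)])
  define V where "V = sqrt t *\<^sub>R (X o\<^sub>L G)"
  define W where "W = sqrt t *\<^sub>R (G o\<^sub>L Y)"
  define B where "B = t *\<^sub>R (G o\<^sub>L (G o\<^sub>L Y))"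
  define E where "E = X o\<^sub>L B"
  have VW: "V \<in> A" "W \<in> A" "is_adjoint W V"
    unfolding V_def W_def
    by (intro scaleR compose X Y G is_adjoint_scaleR is_adjoint_compose Gadj)+
  have "W o\<^sub>L V = G o\<^sub>L (S o\<^sub>L G)"
    using t(1) by (simp add: V_def W_def S_def comp_bilinear comp_assoc)
  also have "\<dots> = P"
    using G Pr(2) by (simp add: C(5)[symmetric] comp_assoc comp_extendD[OF G(5)])
  finally have WV: "W o\<^sub>L V = P" .
  have VWE: "V o\<^sub>L W = E"
    using t(1) by (simp add: V_def W_def E_def B_def comp_bilinear comp_assoc)
  have B: "B \<in> A" "P o\<^sub>L B = B" "B o\<^sub>L X = P"
    using GGS unfolding B_def S_def
    by (auto intro!: scaleR compose G Y simp: comp_bilinear comp_assoc comp_extendD[OF G(2)])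
  have EX: "E o\<^sub>L X = X"
    using B(3) X(2) by (simp add: E_def comp_assoc)
  show thesis
  proof (rule that)
    have "E o\<^sub>L E = E"
      using comp_extendD[OF EX, of B] by (simp add: E_def)
    moreover have "is_adjoint E E"
      unfolding VWE[symmetric] using VW(3) by (intro is_adjoint_compose is_adjoint_sym[OF VW(3)])
    ultimately show "E \<in> projections A"
      using B(1) X(1) by (auto simp: projections_def E_def intro: compose)
    show "range (blinfun_apply E) = range (blinfun_apply X)"
    proof
      show "range (blinfun_apply E) \<subseteq> range (blinfun_apply X)"
        by (auto simp: E_def)
      show "range (blinfun_apply X) \<subseteq> range (blinfun_apply E)"
        using comp_eqD[OF EX, symmetric] by blast
    qed
    show "mvn_equiv A P E"
      unfolding mvn_equiv_def using VW WV VWE by blast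
    show "B o\<^sub>L E = B"
      using comp_extendD[OF B(3), of B] B(2) by (simp add: E_def)
    show "X o\<^sub>L B = E"
      by (simp add: E_def)
  qed (use B in auto)
qed

text \<open>The inverse of an isomorphism between ranges of projections, extended by \<open>0\<close> on the orthogonal
complement, stays in the algebra.\<close>
lemma isomorphism_inverse:
  assumes p: "p \<in> projections A" and q: "q \<in> projections A" and T: "T \<in> A"
    and iso: "isomorphically_onto (blinfun_apply T) (range (blinfun_apply p)) (range (blinfun_apply q))"
  obtains G where "G \<in> A" "p o\<^sub>L G = G" "G o\<^sub>L q = G" "G o\<^sub>L (T o\<^sub>L p) = p" "T o\<^sub>L G = q"
proof -
  obtain c where c: "c > 0" "\<And>x. c * norm (p x) \<le> norm ((T o\<^sub>L p) x)"
    using isomorphically_onto_bounded_below[OF iso] by auto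
  have "T o\<^sub>L p \<in> A" "(T o\<^sub>L p) o\<^sub>L p = T o\<^sub>L p"
    using T projectionsD[OF p] by (simp_all add: compose comp_assoc)
  from bounded_below_range_projection[OF p this c]
  obtain E G where E: "E \<in> projections A" "range (blinfun_apply E) = range (blinfun_apply (T o\<^sub>L p))"
    and G: "G \<in> A" "p o\<^sub>L G = G" "G o\<^sub>L E = G" "G o\<^sub>L (T o\<^sub>L p) = p" "(T o\<^sub>L p) o\<^sub>L G = E"
    by metis
  have "range (blinfun_apply (T o\<^sub>L p)) = range (blinfun_apply q)"
    using iso by (auto simp: isomorphically_onto_def homeomorphism_def image_image)
  with E q have "E = q"
    using projection_eqI by metis
  with G that show thesis
    by (simp add: comp_assoc)
qed

text \<open>If the range of \<open>q\<close> is complementary to the kernel of \<open>p\<close>, then \<open>p\<close> maps the range of \<open>q\<close>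
isomorphically onto the range of \<open>p\<close>. The adjoint map \<open>q p\<close> is the one that the lower bound makes
invertible. Its range is all of the range of \<open>q\<close>, because a vector \<open>y\<close> of the latter that is
orthogonal to it satisfies \<open>p y = 0\<close> and so lies in both summands. The required inverse is the
adjoint of the inverse of \<open>q p\<close>.\<close>
lemma complement_decomp_inverse:
  assumes p: "p \<in> projections A" and q: "q \<in> projections A"
    and decomp: "direct_sum_decomp (range (blinfun_apply q)) (range (blinfun_apply (id_blinfun - p)))"
  obtains B where "B \<in> A" "q o\<^sub>L B = B" "B o\<^sub>L p = B" "B o\<^sub>L (p o\<^sub>L q) = q" "p o\<^sub>L B = p"
proof -
  note pr = projectionsD[OF p] and qr = projectionsD[OF q]
  obtain c where below: "c > 0" "\<And>x. c * norm (p x) \<le> norm ((q o\<^sub>L p) x)"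
    using complement_decomp_bounded_below[OF p q decomp] by auto
  have "q o\<^sub>L p \<in> A" "(q o\<^sub>L p) o\<^sub>L p = q o\<^sub>L p"
    using pr qr by (simp_all add: compose comp_assoc)
  from bounded_below_range_projection[OF p this below]
  obtain E D where E: "E \<in> projections A" "range (blinfun_apply E) = range (blinfun_apply (q o\<^sub>L p))"
    and D: "D \<in> A" "p o\<^sub>L D = D" "D o\<^sub>L E = D" "D o\<^sub>L (q o\<^sub>L p) = p" "(q o\<^sub>L p) o\<^sub>L D = E"
    by metis
  note Er = projectionsD[OF E(1)]
  have qE: "q o\<^sub>L E = E"
    using comp_extendD[OF qr(2)] by (simp add: D(5)[symmetric] comp_assoc)
  have Eq: "E o\<^sub>L q = E"
    by (rule projection_absorb[OF Er(3) qr(3) qE])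
  have Eqp: "E o\<^sub>L (q o\<^sub>L p) = q o\<^sub>L p"
    using D(4) pr(2) by (simp add: D(5)[symmetric] comp_assoc)
  have "E = q"
  proof (rule blinfun_eqI)
    fix z
    define y where "y = q z - E z"
    have qy: "q y = y" and Ey: "E y = 0"
      using comp_eqD[OF qE] comp_eqD[OF Eq] qr(4) Er(4)
      by (simp_all add: y_def blinfun.bilinear_simps)
    have "inner (p y) w = 0" for w
    proof -
      have "inner (p y) w = inner (q y) (p w)"
        using qy by (simp add: is_adjoint_inner[OF pr(3)])
      also have "\<dots> = inner y (E (q (p w)))"
        using comp_eqD[OF Eqp, of w] by (simp add: is_adjoint_inner[OF qr(3)])
      also have "\<dots> = 0"
        using Ey by (simp add: is_adjoint_inner[OF Er(3), symmetric])
      finally show ?thesis .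
    qed
    from this[of "p y"] have "p y = 0"
      by simp
    then have "(id_blinfun - p) y = y"
      by (simp add: blinfun.bilinear_simps)
    then have "y \<in> range (blinfun_apply q) \<inter> range (blinfun_apply (id_blinfun - p))"
      using qy by (metis IntI rangeI)
    then have "y = 0"
      using decomp by (auto simp: direct_sum_decomp_def)
    then show "E z = q z"
      by (simp add: y_def)
  qed
  obtain B where B: "B \<in> A" "is_adjoint B D"
    using adjoint_ex[OF D(1)] .
  note adj = is_adjoint_compose[OF _ B(2)] is_adjoint_compose[OF B(2)]
  have qB: "q o\<^sub>L B = B"
    using is_adjoint_unique[OF adj(2)[OF qr(3)], of B] B(2) D(3) \<open>E = q\<close> by simp
  show thesis
  proof (rule that[OF B(1) qB])
    show "B o\<^sub>L p = B"
      using is_adjoint_unique[OF adj(1)[OF pr(3)], of B] B(2) D(2) by simp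
    show "B o\<^sub>L (p o\<^sub>L q) = q"
      using is_adjoint_unique[OF adj(1)[OF is_adjoint_compose[OF qr(3) pr(3)]], of q]
        D(5) qr(3) \<open>E = q\<close> by simp
    have "p o\<^sub>L (q o\<^sub>L B) = p"
      using is_adjoint_unique[OF adj(2)[OF is_adjoint_compose[OF qr(3) pr(3)]], of p]
        D(4) pr(3) by (simp add: comp_assoc)
    then show "p o\<^sub>L B = p"
      by (simp add: qB)
  qed
qed

section \<open>Equivalence preserves finiteness\<close>

text \<open>Let \<open>V\<close> implement \<open>P \<sim> Q\<close>. An equivalence \<open>U\<close> of \<open>Q\<close> with a proper subprojection \<open>Q'\<close> is pulled
back by \<open>V\<close> to the equivalence \<open>V\<^sup>* U V\<close> of \<open>P\<close> with the subprojection \<open>V\<^sup>* Q' V\<close>, which is proper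
because \<open>V\<close> carries it back to \<open>Q'\<close>.\<close>
lemma finite_projection_transport:
  assumes fin: "finite_projection A P" and eq: "mvn_equiv A P Q" and Q: "Q \<in> projections A"
  shows "finite_projection A Q"
proof -
  have P: "P \<in> projections A"
    using fin by (simp add: finite_projection_def)
  note Pr = projectionsD[OF P] and Qr = projectionsD[OF Q]
  obtain V W where V: "V \<in> A" "W \<in> A" "is_adjoint W V" "W o\<^sub>L V = P" "V o\<^sub>L W = Q"
    using eq by (auto simp: mvn_equiv_def)
  have False if Q': "Q' \<in> projections A" "range (blinfun_apply Q') \<subset> range (blinfun_apply Q)"
    and QQ': "mvn_equiv A Q Q'" for Q'
  proof -
    note Qr' = projectionsD[OF Q'(1)]
    obtain U U' where U: "U \<in> A" "U' \<in> A" "is_adjoint U' U" "U' o\<^sub>L U = Q" "U o\<^sub>L U' = Q'"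
      using QQ' by (auto simp: mvn_equiv_def)
    have QQ: "Q o\<^sub>L Q' = Q'"
    proof (rule blinfun_eqI)
      show "(Q o\<^sub>L Q') x = Q' x" for x
        using range_idempotent_iff[OF Qr(2), of "Q' x"] Q'(2) by auto
    qed
    have QpQ: "Q' o\<^sub>L Q = Q'"
      by (rule projection_absorb[OF Qr'(3) Qr(3) QQ])
    note VP = partial_isometry_absorb[OF V(3,4) Pr(2,3)]
    note VQ = partial_isometry_absorb[OF is_adjoint_sym[OF V(3)] V(5) Qr(2,3)]
    note UQ = partial_isometry_absorb[OF is_adjoint_sym[OF U(3)] U(5) Qr'(2,3)]
    have QU: "Q o\<^sub>L U = U"
      using comp_extendD[OF QQ, of U] UQ(2) by simp
    define R where "R = W o\<^sub>L (Q' o\<^sub>L V)"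
    have R: "R \<in> projections A"
    proof -
      have "R \<in> A"
        unfolding R_def by (intro compose V Qr'(1))
      moreover have "R o\<^sub>L R = R"
        by (simp add: R_def comp_assoc comp_extendD[OF V(5)] comp_extendD[OF QQ]
            comp_extendD[OF Qr'(2)])
      moreover have "is_adjoint R R"
        using is_adjoint_compose[OF is_adjoint_sym[OF V(3)] is_adjoint_compose[OF Qr'(3) V(3)]]
        by (simp add: R_def comp_assoc)
      ultimately show ?thesis
        by (simp add: projections_def)
    qed
    have "mvn_equiv A P R"
      unfolding mvn_equiv_def
    proof (intro bexI conjI)
      show "is_adjoint (W o\<^sub>L (U' o\<^sub>L V)) ((W o\<^sub>L U) o\<^sub>L V)"
        using is_adjoint_compose[OF is_adjoint_compose[OF is_adjoint_sym[OF V(3)] U(3)] V(3)]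
        by simp
      show "(W o\<^sub>L (U' o\<^sub>L V)) o\<^sub>L ((W o\<^sub>L U) o\<^sub>L V) = P"
        using VQ by (simp add: comp_assoc comp_extendD[OF V(5)] comp_extendD[OF QU]
            comp_extendD[OF U(4)] V(4))
      show "((W o\<^sub>L U) o\<^sub>L V) o\<^sub>L (W o\<^sub>L (U' o\<^sub>L V)) = R"
        using partial_isometry_absorb[OF U(3,4) Qr(2,3)]
        by (simp add: R_def comp_assoc comp_extendD[OF V(5)] comp_extendD[OF U(5)]
            comp_extendD[of U Q U])
    qed (intro compose V U)+
    moreover have "range (blinfun_apply R) \<subseteq> range (blinfun_apply P)"
      using comp_eqD[OF VP(2)] by (auto simp: R_def image_iff) metis
    moreover have "range (blinfun_apply R) \<noteq> range (blinfun_apply P)"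
    proof
      assume "range (blinfun_apply R) = range (blinfun_apply P)"
      then have "R = P"
        using projection_eqI[OF R P] by simp
      have "Q' = V o\<^sub>L (R o\<^sub>L W)"
        by (simp add: R_def comp_assoc V(5) comp_extendD[OF V(5)] QpQ QQ)
      also have "\<dots> = Q"
        by (simp add: \<open>R = P\<close> VP V(5))
      finally show False
        using Q'(2) by simp
    qed
    ultimately show False
      using fin R by (auto simp: finite_projection_def)
  qed
  then show ?thesis
    using Q by (auto simp: finite_projection_def)
qed

end

section \<open>Invertible compressions\<close>

text \<open>The operator \<open>B\<close> is the inverse of \<open>p T p\<close> in the corner \<open>p A p\<close>. The inner factors \<open>p\<close> next to \<open>B\<close>
are left out of the last two equations, being absorbed by \<open>B\<close>.\<close>
definition corner_inverse ::
    "('a \<Rightarrow>\<^sub>L 'a :: chilbert_space) \<Rightarrow> ('a \<Rightarrow>\<^sub>L 'a) \<Rightarrow> ('a \<Rightarrow>\<^sub>L 'a) \<Rightarrow> bool"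
  where "corner_inverse p T B \<longleftrightarrow>
    p o\<^sub>L B = B \<and> B o\<^sub>L p = B \<and> p o\<^sub>L (T o\<^sub>L B) = p \<and> B o\<^sub>L (T o\<^sub>L p) = p"

context vn_algebra
begin

lemma invertible_up_to_complement_iff:
  assumes p: "p \<in> projections A"
  shows "invertible_up_to A (id_blinfun - p) (id_blinfun - p) T \<longleftrightarrow> (\<exists>B\<in>A. corner_inverse p T B)"
proof -
  note pp = projectionsD(2)[OF p]
  have "B = p o\<^sub>L B o\<^sub>L p \<and> p o\<^sub>L T o\<^sub>L p o\<^sub>L B = p \<and> B o\<^sub>L p o\<^sub>L T o\<^sub>L p = p
    \<longleftrightarrow> corner_inverse p T B" (is "?L \<longleftrightarrow> ?R") for B
  proof
    assume L: ?L
    then have "B = p o\<^sub>L (B o\<^sub>L p)"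
      by (simp add: comp_assoc)
    from this[symmetric] have "p o\<^sub>L B = B" "B o\<^sub>L p = B"
      by (metis comp_extendD[OF pp], metis comp_assoc pp)
    then show ?R
      using L by (simp add: corner_inverse_def comp_assoc comp_extendD[of B p B])
  next
    assume ?R
    then show ?L
      by (simp add: corner_inverse_def comp_assoc comp_extendD[of B p B])
  qed
  then show ?thesis
    by (simp add: invertible_up_to_def)
qed

lemma isomorphically_onto_compression_iff:
  assumes p: "p \<in> projections A" and T: "T \<in> A"
  shows "isomorphically_onto (blinfun_apply (p o\<^sub>L T)) (range (blinfun_apply p)) (range (blinfun_apply p))
    \<longleftrightarrow> (\<exists>B\<in>A. corner_inverse p T B)"
proof
  note pr = projectionsD[OF p]
  assume "isomorphically_onto (blinfun_apply (p o\<^sub>L T)) (range (blinfun_apply p)) (range (blinfun_apply p))"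
  from isomorphism_inverse[OF p p compose[OF pr(1) T] this]
  obtain G where G: "G \<in> A" "p o\<^sub>L G = G" "G o\<^sub>L p = G" "G o\<^sub>L ((p o\<^sub>L T) o\<^sub>L p) = p"
    "(p o\<^sub>L T) o\<^sub>L G = p" .
  then have "corner_inverse p T G"
    by (simp add: corner_inverse_def comp_assoc comp_extendD[OF G(3)])
  with G(1) show "\<exists>B\<in>A. corner_inverse p T B"
    by blast
next
  assume "\<exists>B\<in>A. corner_inverse p T B"
  then obtain B where B: "p o\<^sub>L B = B" "B o\<^sub>L p = B" "p o\<^sub>L (T o\<^sub>L B) = p" "B o\<^sub>L (T o\<^sub>L p) = p"
    by (auto simp: corner_inverse_def)
  show "isomorphically_onto (blinfun_apply (p o\<^sub>L T)) (range (blinfun_apply p)) (range (blinfun_apply p))"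
    unfolding isomorphically_onto_def
  proof (intro exI homeomorphismI)
    show "blinfun_apply B ` range (blinfun_apply p) \<subseteq> range (blinfun_apply p)"
      using comp_eqD[OF B(1), symmetric] by blast
    show "B ((p o\<^sub>L T) x) = x" if "x \<in> range (blinfun_apply p)" for x
      using that comp_eqD[OF B(2)] comp_eqD[OF B(4)] by auto
    show "(p o\<^sub>L T) (B y) = y" if "y \<in> range (blinfun_apply p)" for y
      using that comp_eqD[OF B(3)] projectionsD(4)[OF p] by auto
  qed (auto intro!: continuous_intros)
qed

lemma spectrum_on_compression:
  assumes p: "p \<in> projections A" and F: "F \<in> A"
  shows "c \<notin> spectrum_on (range (blinfun_apply p)) (blinfun_apply (p o\<^sub>L F)) \<longleftrightarrow>
    (\<exists>B\<in>A. corner_inverse p (F - scalar_op c) B)"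
proof -
  have "p \<in> clinear_ops"
    using projectionsD(1)[OF p] bicommutant by (auto simp: commutant_def)
  then have "(p o\<^sub>L F) x - scaleC c x = (p o\<^sub>L (F - scalar_op c)) x" if "x \<in> range (blinfun_apply p)" for x
    using that projectionsD(4)[OF p]
    by (auto simp: blinfun.bilinear_simps scalar_op.rep_eq clinear_ops_def)
  then have "isomorphically_onto (\<lambda>x. (p o\<^sub>L F) x - scaleC c x) (range (blinfun_apply p)) (range (blinfun_apply p))
    \<longleftrightarrow> isomorphically_onto (blinfun_apply (p o\<^sub>L (F - scalar_op c))) (range (blinfun_apply p)) (range (blinfun_apply p))"
    by (rule isomorphically_onto_cong)
  then show ?thesis
    using isomorphically_onto_compression_iff[OF p diff[OF F scalar]] by (simp add: spectrum_on_def)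
qed

text \<open>\<open>p T' B\<close> and \<open>B T' p\<close> are close to \<open>p T B = p\<close> and \<open>B T p = p\<close>, hence invertible in the corner.
This gives a right and a left inverse of \<open>p T' p\<close>, which must coincide.\<close>
lemma corner_inverse_perturb:
  assumes p: "p \<in> projections A" and T': "T' \<in> A" and B: "B \<in> A" "corner_inverse p T B"
    and small: "norm (T - T') * norm B < 1"
  shows "\<exists>B'\<in>A. corner_inverse p T' B'"
proof -
  note pr = projectionsD[OF p]
  have inv: "p o\<^sub>L B = B" "B o\<^sub>L p = B" "p o\<^sub>L (T o\<^sub>L B) = p" "B o\<^sub>L (T o\<^sub>L p) = p"
    using B(2) by (auto simp: corner_inverse_def)
  have norm_p: "norm p \<le> 1"
    using norm_projection_le[OF p] by (intro norm_blinfun_bound) auto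
  have "norm (p - (p o\<^sub>L (T' o\<^sub>L B))) = norm (p o\<^sub>L ((T - T') o\<^sub>L B))"
    by (simp add: comp_bilinear inv)
  also have "\<dots> \<le> 1 * (norm (T - T') * norm B)"
    by (rule order_trans[OF norm_blinfun_compose mult_mono[OF norm_p norm_blinfun_compose]]) auto
  finally have near_r: "norm (p - (p o\<^sub>L (T' o\<^sub>L B))) < 1"
    using small by simp
  have "norm (p - (B o\<^sub>L (T' o\<^sub>L p))) = norm (B o\<^sub>L ((T - T') o\<^sub>L p))"
    by (simp add: comp_bilinear inv)
  also have "\<dots> \<le> norm B * (norm (T - T') * 1)"
    by (intro order_trans[OF norm_blinfun_compose] mult_left_mono
        order_trans[OF norm_blinfun_compose mult_left_mono[OF norm_p]]) auto
  finally have near_l: "norm (p - (B o\<^sub>L (T' o\<^sub>L p))) < 1"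
    using small by (simp add: mult.commute)
  obtain R where R: "R \<in> A" "p o\<^sub>L R = R" "R o\<^sub>L p = R" "(p o\<^sub>L (T' o\<^sub>L B)) o\<^sub>L R = p"
    by (rule corner_neumann[OF p _ _ _ near_r])
      (simp_all add: compose pr T' B comp_assoc inv(2) comp_extendD[OF pr(2)])
  obtain L where L: "L \<in> A" "p o\<^sub>L L = L" "L o\<^sub>L p = L" "L o\<^sub>L (B o\<^sub>L (T' o\<^sub>L p)) = p"
    by (rule corner_neumann[OF p _ _ _ near_l])
      (simp_all add: compose pr T' B comp_assoc comp_extendD[OF inv(1)])
  define B' where "B' = B o\<^sub>L R"
  have right: "p o\<^sub>L B' = B'" "B' o\<^sub>L p = B'" "p o\<^sub>L (T' o\<^sub>L B') = p"
    using R by (simp_all add: B'_def comp_assoc comp_extendD[OF inv(1)])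
  have "L o\<^sub>L B = (L o\<^sub>L B) o\<^sub>L (p o\<^sub>L (T' o\<^sub>L B'))"
    by (simp add: right(3) comp_assoc inv(2))
  also have "\<dots> = (L o\<^sub>L (B o\<^sub>L (T' o\<^sub>L p))) o\<^sub>L B'"
    by (simp add: comp_assoc comp_extendD[OF inv(2)] right(1))
  also have "\<dots> = B'"
    by (simp add: L(4) right(1))
  finally have "B' o\<^sub>L (T' o\<^sub>L p) = p"
    using L(4) by (metis comp_assoc)
  with right have "corner_inverse p T' B'"
    by (simp add: corner_inverse_def)
  then show ?thesis
    using compose[OF B(1) R(1)] B'_def by blast
qed

section \<open>Weyl operators are those with an invertible compression\<close>

text \<open>\<open>p T p\<close> is \<open>T\<close> from the range of \<open>p\<close> onto that of \<open>q\<close>, followed by \<open>p\<close> from the range of \<open>q\<close> back onto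
that of \<open>p\<close>. Both maps have inverses in the algebra, and their product is the inverse of \<open>p T p\<close>.\<close>
lemma K_Phi0_tilde_imp_corner_inverse:
  assumes "T \<in> K_Phi0_tilde A"
  obtains p B where "p \<in> projections A" "finite_projection A (id_blinfun - p)"
    "B \<in> A" "corner_inverse p T B"
proof -
  obtain P Q where P: "finite_projection A P" and Q: "finite_projection A Q" and T: "T \<in> A"
    and iso: "isomorphically_onto (blinfun_apply T)
      (range (blinfun_apply (id_blinfun - P))) (range (blinfun_apply (id_blinfun - Q)))"
    and decomp: "direct_sum_decomp (range (blinfun_apply (id_blinfun - Q))) (range (blinfun_apply P))"
    using assms by (auto simp: K_Phi0_tilde_def)
  define p where "p = id_blinfun - P"
  define q where "q = id_blinfun - Q"
  have p: "p \<in> projections A" and q: "q \<in> projections A" and P_eq: "P = id_blinfun - p"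
    using P Q complement by (auto simp: p_def q_def finite_projection_def)
  obtain G where G: "G \<in> A" "p o\<^sub>L G = G" "G o\<^sub>L q = G" "G o\<^sub>L (T o\<^sub>L p) = p" "T o\<^sub>L G = q"
    using isomorphism_inverse[OF p q T iso[folded p_def q_def]] .
  obtain B where B: "B \<in> A" "q o\<^sub>L B = B" "B o\<^sub>L p = B" "B o\<^sub>L (p o\<^sub>L q) = q" "p o\<^sub>L B = p"
    using complement_decomp_inverse[OF p q decomp[folded q_def, unfolded P_eq]] .
  have qTp: "q o\<^sub>L (T o\<^sub>L p) = T o\<^sub>L p"
    using G(4) projectionsD(2)[OF p] by (simp add: G(5)[symmetric] comp_assoc)
  have "G o\<^sub>L (B o\<^sub>L (T o\<^sub>L p)) = G o\<^sub>L ((B o\<^sub>L (p o\<^sub>L q)) o\<^sub>L (T o\<^sub>L p))"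
    by (simp add: comp_assoc qTp comp_extendD[OF B(3)])
  also have "\<dots> = p"
    by (simp add: B(4) qTp G(4))
  finally have "corner_inverse p T (G o\<^sub>L B)"
    using G B by (simp add: corner_inverse_def comp_assoc comp_extendD[OF G(2)] comp_extendD[OF G(5)])
  then show thesis
    using that[OF p _ compose[OF G(1) B(1)]] P P_eq by simp
qed

text \<open>The operator \<open>T B\<close> is idempotent with the range of \<open>T p\<close> as its range and the range of \<open>I - p\<close> as its
kernel. So the range of \<open>T p\<close> is the range of a projection \<open>q\<close> and is complementary to the range
of \<open>I - p\<close>. The idempotent \<open>I - T B\<close> then inverts \<open>(I - q) (I - p)\<close>, which transfers finiteness
from \<open>I - p\<close> to \<open>I - q\<close>.\<close>
lemma corner_inverse_imp_K_Phi0_tilde: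
  assumes p: "p \<in> projections A" and fin: "finite_projection A (id_blinfun - p)"
    and T: "T \<in> A" and B: "B \<in> A" "corner_inverse p T B"
  shows "T \<in> K_Phi0_tilde A"
proof -
  note pr = projectionsD[OF p]
  have inv: "p o\<^sub>L B = B" "B o\<^sub>L p = B" "p o\<^sub>L (T o\<^sub>L B) = p" "B o\<^sub>L (T o\<^sub>L p) = p"
    using B(2) by (auto simp: corner_inverse_def)
  obtain c where c: "c > 0" "\<And>x. c * norm (p x) \<le> norm ((T o\<^sub>L p) x)"
    using left_inverse_bounded_below[OF inv(4)] by blast
  have "T o\<^sub>L p \<in> A" "(T o\<^sub>L p) o\<^sub>L p = T o\<^sub>L p"
    using T pr by (simp_all add: compose comp_assoc)
  from bounded_below_range_projection[OF p this c]
  obtain q G where q: "q \<in> projections A" "range (blinfun_apply q) = range (blinfun_apply (T o\<^sub>L p))"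
    and G: "G \<in> A" "p o\<^sub>L G = G" "G o\<^sub>L q = G" "G o\<^sub>L (T o\<^sub>L p) = p" "(T o\<^sub>L p) o\<^sub>L G = q"
    by metis
  note qr = projectionsD[OF q(1)]
  have TG: "T o\<^sub>L G = q"
    using G(2,5) by (simp add: comp_assoc)
  have qTp: "q o\<^sub>L (T o\<^sub>L p) = T o\<^sub>L p"
    using G(4) pr(2) by (simp add: TG[symmetric] comp_assoc)
  define R where "R = id_blinfun - p"
  define Q where "Q = id_blinfun - q"
  have R: "R \<in> projections A" and Q: "Q \<in> projections A"
    unfolding R_def Q_def by (intro complement p q)+
  define L where "L = id_blinfun - (T o\<^sub>L B)"
  have TBq: "T o\<^sub>L (B o\<^sub>L (q o\<^sub>L U)) = q o\<^sub>L U" for U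
    using comp_extendD[OF inv(4), of "G o\<^sub>L U"]
    by (simp add: TG[symmetric] comp_assoc comp_extendD[OF G(2)])
  have qTB: "q o\<^sub>L (T o\<^sub>L B) = T o\<^sub>L B"
    using comp_extendD[OF qTp, of B] by (simp add: comp_assoc inv(1))
  have LQR: "L o\<^sub>L (Q o\<^sub>L R) = R"
    using TBq[of id_blinfun]
    by (simp add: L_def Q_def R_def comp_bilinear comp_assoc inv(2) TBq)
  have QRL: "(Q o\<^sub>L R) o\<^sub>L L = Q"
    by (simp add: L_def Q_def R_def comp_bilinear comp_assoc inv(3) qTB)
  obtain d where d: "d > 0" "\<And>x. d * norm (R x) \<le> norm ((Q o\<^sub>L R) x)"
    using left_inverse_bounded_below[OF LQR] by blast
  have "Q o\<^sub>L R \<in> A" "(Q o\<^sub>L R) o\<^sub>L R = Q o\<^sub>L R"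
    using projectionsD[OF R] projectionsD[OF Q] by (simp_all add: compose comp_assoc)
  from bounded_below_range_projection[OF R this d]
  obtain E where E: "E \<in> projections A" "range (blinfun_apply E) = range (blinfun_apply (Q o\<^sub>L R))"
    "mvn_equiv A R E"
    by metis
  have "range (blinfun_apply (Q o\<^sub>L R)) = range (blinfun_apply Q)"
  proof
    show "range (blinfun_apply (Q o\<^sub>L R)) \<subseteq> range (blinfun_apply Q)"
      by auto
    show "range (blinfun_apply Q) \<subseteq> range (blinfun_apply (Q o\<^sub>L R))"
      using comp_eqD[OF QRL, symmetric] by blast
  qed
  then have "E = Q"
    using projection_eqI[OF E(1) Q] E(2) by simp
  then have Q_fin: "finite_projection A Q"
    using finite_projection_transport[OF fin[folded R_def] _ Q] E(3) by simp
  have "isomorphically_onto (blinfun_apply T) (range (blinfun_apply p)) (range (blinfun_apply q))"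
    unfolding isomorphically_onto_def
  proof (intro exI homeomorphismI)
    show "blinfun_apply T ` range (blinfun_apply p) \<subseteq> range (blinfun_apply q)"
      using q(2) by auto
    show "blinfun_apply G ` range (blinfun_apply q) \<subseteq> range (blinfun_apply p)"
      using comp_eqD[OF G(2), symmetric] by blast
    show "G (T x) = x" if "x \<in> range (blinfun_apply p)" for x
      using that comp_eqD[OF G(4)] by auto
    show "T (G y) = y" if "y \<in> range (blinfun_apply q)" for y
      using that comp_eqD[OF TG] qr(4) by auto
  qed (auto intro!: continuous_intros)
  moreover have "direct_sum_decomp (range (blinfun_apply q)) (range (blinfun_apply R))"
    unfolding direct_sum_decomp_def
  proof (intro conjI)
    have "z = 0" if z: "z \<in> range (blinfun_apply q)" "z \<in> range (blinfun_apply R)" for z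
    proof -
      obtain x where x: "z = T (p x)"
        using z(1) q(2) by auto
      have "p z = 0"
        using z(2) pr(4) by (auto simp: R_def blinfun.bilinear_simps)
      then have "B z = 0"
        using comp_eqD[OF inv(2), of z] by simp
      then have "p x = 0"
        using comp_eqD[OF inv(4), of x] x by simp
      then show ?thesis
        by (simp add: x)
    qed
    then show "range (blinfun_apply q) \<inter> range (blinfun_apply R) = {0}"
      using rangeI[of "blinfun_apply q" 0] rangeI[of "blinfun_apply R" 0] by auto
    have "\<exists>x y. h = x + y \<and> x \<in> range (blinfun_apply q) \<and> y \<in> range (blinfun_apply R)" for h
    proof (intro exI conjI)
      show "h = T (B h) + (h - T (B h))"
        by simp
      show "T (B h) \<in> range (blinfun_apply q)"
        using comp_eqD[OF qTB, of h] by (metis blinfun_apply_blinfun_compose rangeI)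
      have "R (h - T (B h)) = h - T (B h)"
        using comp_eqD[OF inv(3), of h] by (simp add: R_def blinfun.bilinear_simps)
      then show "h - T (B h) \<in> range (blinfun_apply R)"
        by (metis rangeI)
    qed
    then show "{x + y |x y. x \<in> range (blinfun_apply q) \<and> y \<in> range (blinfun_apply R)} = UNIV"
      by blast
  qed
  moreover have "id_blinfun - R = p" "id_blinfun - Q = q"
    by (simp_all add: R_def Q_def)
  ultimately have "finite_projection A R \<and> finite_projection A Q \<and>
      isomorphically_onto (blinfun_apply T)
        (range (blinfun_apply (id_blinfun - R))) (range (blinfun_apply (id_blinfun - Q))) \<and>
      direct_sum_decomp (range (blinfun_apply (id_blinfun - Q))) (range (blinfun_apply R))"
    using fin[folded R_def] Q_fin by simp
  then show ?thesis
    unfolding K_Phi0_tilde_def using T by blast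
qed

theorem K_Phi0_tilde_iff_compression:
  "T \<in> K_Phi0_tilde A \<longleftrightarrow> T \<in> A \<and> (\<exists>p\<in>projections A. finite_projection A (id_blinfun - p) \<and>
    (\<exists>B\<in>A. corner_inverse p T B))"
proof
  assume "T \<in> K_Phi0_tilde A"
  moreover from this have "T \<in> A"
    by (simp add: K_Phi0_tilde_def)
  ultimately show "T \<in> A \<and> (\<exists>p\<in>projections A. finite_projection A (id_blinfun - p) \<and>
      (\<exists>B\<in>A. corner_inverse p T B))"
    using K_Phi0_tilde_imp_corner_inverse by blast
qed (use corner_inverse_imp_K_Phi0_tilde in blast)

lemma openin_K_Phi0_tilde: "openin (top_of_set A) (K_Phi0_tilde A)"
  unfolding openin_euclidean_subtopology_iff
proof (intro conjI ballI)
  show "K_Phi0_tilde A \<subseteq> A"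
    by (auto simp: K_Phi0_tilde_def)
  fix T
  assume "T \<in> K_Phi0_tilde A"
  then obtain p B where p: "p \<in> projections A" "finite_projection A (id_blinfun - p)"
    and B: "B \<in> A" "corner_inverse p T B"
    using K_Phi0_tilde_imp_corner_inverse by blast
  have "T' \<in> K_Phi0_tilde A" if T': "T' \<in> A" "dist T' T < 1 / (norm B + 1)" for T'
  proof -
    have "norm (T - T') * (norm B + 1) < 1"
      using T'(2) by (simp add: dist_norm norm_minus_commute field_simps add_pos_nonneg)
    then have "norm (T - T') * norm B < 1"
      using norm_ge_zero[of "T - T'"] unfolding distrib_left mult_1_right by linarith
    then show ?thesis
      using corner_inverse_perturb[OF p(1) T'(1) B] K_Phi0_tilde_iff_compression p T' by blast
  qed
  moreover have "0 < 1 / (norm B + 1)"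
    by (simp add: add_nonneg_pos)
  ultimately show "\<exists>e>0. \<forall>T'\<in>A. dist T' T < e \<longrightarrow> T' \<in> K_Phi0_tilde A"
    by blast
qed

lemma K_Phi0_tilde_subset_K_Phi0: "K_Phi0_tilde A \<subseteq> K_Phi0 A"
proof
  fix T
  assume "T \<in> K_Phi0_tilde A"
  then obtain p B where T: "T \<in> A" and p: "p \<in> projections A" and fin: "finite_projection A (id_blinfun - p)"
    and B: "B \<in> A" "corner_inverse p T B"
    using K_Phi0_tilde_iff_compression by blast
  have "mvn_equiv A (id_blinfun - p) (id_blinfun - p)"
    unfolding mvn_equiv_def using projectionsD[OF complement[OF p]] by blast
  moreover have "invertible_up_to A (id_blinfun - p) (id_blinfun - p) T"
    using invertible_up_to_complement_iff[OF p] B by blast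
  ultimately show "T \<in> K_Phi0 A"
    unfolding K_Phi0_def using T fin by blast
qed

end

theorem corollary4p10:
  fixes A :: "('a :: chilbert_space \<Rightarrow>\<^sub>L 'a) set"
  assumes "von_neumann_algebra A" and "properly_infinite A"
  shows "openin (top_of_set A) (K_Phi0_tilde A) \<and>
    K_Phi0_tilde A \<subseteq> K_Phi0 A \<and>
    (\<forall>F\<in>A. sigma_eW A F =
      (\<Inter>P \<in> {P \<in> projections A. finite_projection A (id_blinfun - P)}.
        spectrum_on (range (blinfun_apply P)) (blinfun_apply (P o\<^sub>L F))))"
proof -
  interpret vn_algebra A
    by (rule vn_algebra.intro) (rule assms(1))
  have "c \<in> sigma_eW A F \<longleftrightarrow>
      (\<forall>P \<in> {P \<in> projections A. finite_projection A (id_blinfun - P)}.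
        c \<in> spectrum_on (range (blinfun_apply P)) (blinfun_apply (P o\<^sub>L F)))"
    if F: "F \<in> A" for F c
    using spectrum_on_compression[OF _ F, of _ c] diff[OF F scalar]
    by (auto simp: sigma_eW_def K_Phi0_tilde_iff_compression)
  then show ?thesis
    using openin_K_Phi0_tilde K_Phi0_tilde_subset_K_Phi0 by blast
qed

end
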